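(* For every composite integer $n>6$, there exists a Latin square of order $n$ that is anti-king but not anti-queen.
   Context: A Latin square of order $n$ is an $n\times n$ table filled with the integers $1,\dots,n$ so that each integer appears exactly once in each row and in each column. A Latin square is anti-king if no two distinct cells that are horizontally, vertically or diagonally adjacent (a chess king's move apart, no wrap-around) contain the same number. A Latin square is anti-queen if no two distinct cells separated by a chess queen's move (in the same row, the same column, or on the same diagonal of any length in either diagonal direction, no wrap-around) contain the same number. *)

theory Defs
  imports "HOL-Computational_Algebra.Primes"
begin

text \<open>
  A table of order \<open>n\<close> is a function \<open>L\<close> on row and column indices, of which only the values on
  \<open>{1..n} \<times> {1..n}\<close> matter. Coordinates are cast to \<open>int\<close> where they are subtracted.
\<close>

definition latin_square :: "nat \<Rightarrow> (nat \<Rightarrow> nat \<Rightarrow> nat) \<Rightarrow> bool" where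
  "latin_square n L \<longleftrightarrow>
     (\<forall>i\<in>{1..n}. \<forall>j\<in>{1..n}. L i j \<in> {1..n}) \<and>
     (\<forall>i\<in>{1..n}. \<forall>k\<in>{1..n}. \<exists>!j. j \<in> {1..n} \<and> L i j = k) \<and>
     (\<forall>j\<in>{1..n}. \<forall>k\<in>{1..n}. \<exists>!i. i \<in> {1..n} \<and> L i j = k)"

definition king_move :: "nat \<times> nat \<Rightarrow> nat \<times> nat \<Rightarrow> bool" where
  "king_move c d \<longleftrightarrow> c \<noteq> d \<and>
     \<bar>int (fst c) - int (fst d)\<bar> \<le> 1 \<and> \<bar>int (snd c) - int (snd d)\<bar> \<le> 1"

definition queen_move :: "nat \<times> nat \<Rightarrow> nat \<times> nat \<Rightarrow> bool" where
  "queen_move c d \<longleftrightarrow> c \<noteq> d \<and>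
     (fst c = fst d \<or> snd c = snd d \<or>
      \<bar>int (fst c) - int (fst d)\<bar> = \<bar>int (snd c) - int (snd d)\<bar>)"

definition anti_king :: "nat \<Rightarrow> (nat \<Rightarrow> nat \<Rightarrow> nat) \<Rightarrow> bool" where
  "anti_king n L \<longleftrightarrow>
     (\<forall>c \<in> {1..n} \<times> {1..n}. \<forall>d \<in> {1..n} \<times> {1..n}.
        king_move c d \<longrightarrow> L (fst c) (snd c) \<noteq> L (fst d) (snd d))"

definition anti_queen :: "nat \<Rightarrow> (nat \<Rightarrow> nat \<Rightarrow> nat) \<Rightarrow> bool" where
  "anti_queen n L \<longleftrightarrow>
     (\<forall>c \<in> {1..n} \<times> {1..n}. \<forall>d \<in> {1..n} \<times> {1..n}.
        queen_move c d \<longrightarrow> L (fst c) (snd c) \<noteq> L (fst d) (snd d))"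

end

theory Submission
  imports Defs
begin

text \<open>
  The square \<open>L i j = i + b j\<close> modulo \<open>n\<close> is Latin when \<open>b\<close> is a unit, anti-king when moreover
  \<open>b\<close> is different from \<open>1\<close> and \<open>-1\<close>, and fails to be anti-queen as soon as \<open>b + 1\<close> is not a unit:
  with \<open>g = gcd (b + 1) n > 1\<close>, moving \<open>n / g\<close> steps along the diagonal does not change the entry.
  If \<open>n = 2 m\<close>, one can take \<open>b\<close> to be \<open>m - 1\<close> or \<open>m - 2\<close>, whichever is odd. If \<open>n\<close> is odd, one can
  take \<open>b = p - 1\<close> for the least prime factor \<open>p\<close> of \<open>n\<close>, because all prime factors of \<open>p - 1\<close> are
  smaller than \<open>p\<close>.
\<close>

definition linear_square :: "nat \<Rightarrow> nat \<Rightarrow> nat \<Rightarrow> nat \<Rightarrow> nat" where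
  "linear_square n b i j = (i + b * j) mod n + 1"

text \<open>Whether two entries agree depends only on the displacement between their cells; rows,
  columns, king moves and queen moves are all treated through this criterion.\<close>

lemma linear_square_eq_iff:
  "linear_square n b i j = linear_square n b i' j' \<longleftrightarrow>
     int n dvd (int i - int i') + int b * (int j - int j')"
proof -
  have "linear_square n b i j = linear_square n b i' j' \<longleftrightarrow>
      int (i + b * j) mod int n = int (i' + b * j') mod int n"
    unfolding linear_square_def by (metis add_right_cancel of_nat_eq_iff of_nat_mod)
  also have "\<dots> \<longleftrightarrow> int n dvd (int i - int i') + int b * (int j - int j')"
    by (simp add: mod_eq_dvd_iff algebra_simps)
  finally show ?thesis .
qed

lemma int_dvd_small_eq_0:
  fixes x :: int
  assumes "int n dvd x" and "\<bar>x\<bar> < int n"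
  shows "x = 0"
proof (rule ccontr)
  assume "x \<noteq> 0"
  with assms(1) have "\<bar>int n\<bar> \<le> \<bar>x\<bar>"
    by (intro dvd_imp_le_int)
  with assms(2) show False by simp
qed

text \<open>An injective self-map of a finite set is also surjective, so injectivity along rows and
  columns is enough for the Latin property.\<close>

lemma ex1_of_inj_on_endo:
  assumes "finite A" and "inj_on f A" and "f ` A \<subseteq> A" and "k \<in> A"
  shows "\<exists>!x. x \<in> A \<and> f x = k"
proof -
  have "f ` A = A"
    using assms by (intro endo_inj_surj)
  with \<open>k \<in> A\<close> obtain x where "x \<in> A" "f x = k"
    by (metis imageE)
  with assms(2) show ?thesis
    by (metis inj_onD)
qed

lemma latin_square_linear_square:
  assumes "n > 0" and "coprime b n"
  shows "latin_square n (linear_square n b)"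
proof -
  have entry: "linear_square n b i j \<in> {1..n}" for i j
    using \<open>n > 0\<close> by (simp add: linear_square_def Suc_le_eq)
  have row: "inj_on (\<lambda>j. linear_square n b i j) {1..n}" for i
  proof (rule inj_onI)
    fix j j' assume jj: "j \<in> {1..n}" "j' \<in> {1..n}"
      and "linear_square n b i j = linear_square n b i j'"
    then have "int n dvd int b * (int j - int j')"
      by (simp add: linear_square_eq_iff)
    \<comment> \<open>Coprimality cancels the factor \<open>b\<close>; two indices in
      \<open>{1..n}\<close> that are congruent modulo \<open>n\<close> then coincide.\<close>
    moreover have "coprime (int n) (int b)"
      using assms(2) by (simp add: coprime_commute)
    ultimately have "int n dvd int j - int j'"
      by (simp add: coprime_dvd_mult_right_iff)
    with jj have "int j - int j' = 0"
      by (intro int_dvd_small_eq_0) auto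
    then show "j = j'" by simp
  qed
  have col: "inj_on (\<lambda>i. linear_square n b i j) {1..n}" for j
  proof (rule inj_onI)
    fix i i' assume ii: "i \<in> {1..n}" "i' \<in> {1..n}"
      and "linear_square n b i j = linear_square n b i' j"
    then have "int n dvd int i - int i'"
      by (simp add: linear_square_eq_iff)
    with ii have "int i - int i' = 0"
      by (intro int_dvd_small_eq_0) auto
    then show "i = i'" by simp
  qed
  show ?thesis
    unfolding latin_square_def
  proof (intro conjI ballI)
    show "linear_square n b i j \<in> {1..n}" for i j
      by (rule entry)
    show "\<exists>!j. j \<in> {1..n} \<and> linear_square n b i j = k" if "k \<in> {1..n}" for i k
      by (rule ex1_of_inj_on_endo[OF finite_atLeastAtMost row image_subsetI[OF entry] that])
    show "\<exists>!i. i \<in> {1..n} \<and> linear_square n b i j = k" if "k \<in> {1..n}" for j k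
      by (rule ex1_of_inj_on_endo[OF finite_atLeastAtMost col image_subsetI[OF entry] that])
  qed
qed

text \<open>A king displacement \<open>(x, y)\<close> gives \<open>x + b * y\<close> absolute value
  at most \<open>b + 1 < n\<close>, and the value is nonzero since \<open>b > 1\<close>, so
  \<open>n\<close> cannot divide it.\<close>

lemma anti_king_linear_square:
  assumes "1 < b" and "b + 1 < n"
  shows "anti_king n (linear_square n b)"
  unfolding anti_king_def
proof (intro ballI impI notI)
  fix c d assume king: "king_move c d"
    and eq: "linear_square n b (fst c) (snd c) = linear_square n b (fst d) (snd d)"
  define x where "x = int (fst c) - int (fst d)"
  define y where "y = int (snd c) - int (snd d)"
  have xy: "x \<in> {-1, 0, 1}" "y \<in> {-1, 0, 1}" "x \<noteq> 0 \<or> y \<noteq> 0"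
    using king by (auto simp: king_move_def x_def y_def prod_eq_iff)
  have "int n dvd x + int b * y"
    using eq by (simp add: linear_square_eq_iff x_def y_def)
  moreover have "\<bar>x + int b * y\<bar> < int n" and "x + int b * y \<noteq> 0"
    using xy assms by auto
  ultimately show False
    using int_dvd_small_eq_0[of n "x + int b * y"] by simp
qed

lemma not_anti_queen_linear_square:
  assumes "n > 0" and "\<not> coprime (b + 1) n"
  shows "\<not> anti_queen n (linear_square n b)"
proof
  assume queen: "anti_queen n (linear_square n b)"
  define g where "g = gcd (b + 1) n"
  obtain d where d: "n = g * d"
    unfolding g_def by (meson dvdE gcd_dvd2)
  have "g > 1"
    using assms by (simp add: g_def coprime_iff_gcd_eq_1 nat_neq_iff)
  \<comment> \<open>These bounds make \<open>(1 + d, 1 + d)\<close> a cell of the square other than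
    \<open>(1, 1)\<close>.\<close>
  then have "0 < d" "d < n"
    using d \<open>n > 0\<close> by auto
  obtain e where e: "b + 1 = g * e"
    unfolding g_def by (meson dvdE gcd_dvd1)
  have "int d + int b * int d = int (d * (b + 1))"
    by (simp add: algebra_simps)
  also have "\<dots> = int n * int e"
    unfolding e d by simp
  finally have "linear_square n b (1 + d) (1 + d) = linear_square n b 1 1"
    by (simp add: linear_square_eq_iff)
  moreover have "queen_move (1 + d, 1 + d) (1, 1)"
    using \<open>0 < d\<close> by (simp add: queen_move_def)
  moreover have "(1 + d, 1 + d) \<in> {1..n} \<times> {1..n}" "(1, 1) \<in> {1..n} \<times> {1..n}"
    using \<open>d < n\<close> by auto
  ultimately show False
    using queen unfolding anti_queen_def by fastforce
qed

lemma exists_unit_with_nonunit_successor_even: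
  fixes n :: nat
  assumes "n > 6" and "even n"
  shows "\<exists>b. 1 < b \<and> b + 1 < n \<and> coprime b n \<and> \<not> coprime (b + 1) n"
proof -
  obtain m where m: "n = 2 * m"
    using assms(2) by (elim evenE)
  \<comment> \<open>An odd \<open>b\<close> coprime to \<open>m\<close> is coprime to
    \<open>2 * m\<close>, while \<open>b + 1\<close> and \<open>n\<close> share the factor
    2.\<close>
  have "\<exists>b. 1 < b \<and> b < m \<and> odd b \<and> coprime b m"
  proof (cases "even m")
    case True
    then have "odd (m - 1)"
      using assms m by auto
    moreover have "coprime (m - 1) m"
      using assms m by (intro coprime_diff_one_left_nat) simp
    ultimately show ?thesis
      using assms m by (intro exI[of _ "m - 1"]) auto
  next
    case False
    then have "odd (m - 2)"
      using assms m by auto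
    \<comment> \<open>A common divisor divides the difference 2, and it is not 2 because
      \<open>m\<close> is odd.\<close>
    moreover have "coprime (m - 2) m"
    proof (rule coprimeI)
      fix c assume c: "c dvd m - 2" "c dvd m"
      then have "c dvd m - (m - 2)"
        by (rule_tac dvd_diff_nat)
      then have "c dvd 2"
        using assms m by simp
      then have "c = 1 \<or> c = 2"
        using two_is_prime_nat by (simp add: prime_nat_iff)
      with c False show "is_unit c" by auto
    qed
    ultimately show ?thesis
      using assms m by (intro exI[of _ "m - 2"]) auto
  qed
  then obtain b where b: "1 < b" "b < m" "odd b" "coprime b m"
    by blast
  then have "coprime b n"
    by (simp add: m)
  moreover have "\<not> coprime (b + 1) n"
    using \<open>odd b\<close> assms(2) by (meson coprime_common_divisor odd_one odd_even_add)
  ultimately show ?thesis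
    using b m by (intro exI[of _ b]) auto
qed

lemma exists_unit_with_nonunit_successor_odd:
  fixes n :: nat
  assumes "n > 1" and "\<not> prime n" and "odd n"
  shows "\<exists>b. 1 < b \<and> b + 1 < n \<and> coprime b n \<and> \<not> coprime (b + 1) n"
proof -
  define p where "p = (LEAST p. prime p \<and> p dvd n)"
  have "\<exists>p. prime p \<and> p dvd n"
    using assms(1) by (intro prime_factor_nat) simp
  then have p: "prime p" "p dvd n"
    unfolding p_def by (metis (mono_tags, lifting) LeastI_ex)+
  have least: "p \<le> q" if "prime q" "q dvd n" for q
    unfolding p_def using that by (intro Least_le) simp
  \<comment> \<open>This ensures \<open>p - 1 > 1\<close>.\<close>
  have "p \<noteq> 2"
    using p assms(3) by auto
  with p have "2 < p"
    using prime_ge_2_nat[of p] by simp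
  \<comment> \<open>Here \<open>n\<close> being composite enters; with \<open>b = p - 1\<close> this
    is the bound \<open>b + 1 < n\<close>.\<close>
  have "p < n"
    using p assms dvd_imp_le[of p n] by (cases "p = n") auto
  have "coprime (p - 1) n"
  proof (rule ccontr)
    assume "\<not> coprime (p - 1) n"
    \<comment> \<open>Such a \<open>q\<close> would be a prime factor of \<open>n\<close> below
      \<open>p\<close>, against the minimality of \<open>p\<close>.\<close>
    then obtain q where q: "prime q" "q dvd p - 1" "q dvd n"
      by (metis coprime_iff_gcd_eq_1 gcd_greatest_iff prime_factor_nat)
    then have "q \<le> p - 1"
      using \<open>2 < p\<close> by (intro dvd_imp_le) auto
    then show False
      using least[OF q(1,3)] \<open>2 < p\<close> by simp
  qed
  moreover have "\<not> coprime (p - 1 + 1) n"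
    using p \<open>2 < p\<close> by (simp add: prime_imp_coprime_nat coprime_absorb_left)
  ultimately show ?thesis
    using \<open>2 < p\<close> \<open>p < n\<close> by (intro exI[of _ "p - 1"]) auto
qed

theorem theorem13:
  fixes n :: nat
  assumes "n > 6" and "\<not> prime n"
  shows "\<exists>L. latin_square n L \<and> anti_king n L \<and> \<not> anti_queen n L"
proof -
  have "n > 1" using assms(1) by simp
  \<comment> \<open>The parity of \<open>n\<close> decides which of the two existence lemmas
    supplies \<open>b\<close>.\<close>
  then obtain b where "1 < b" "b + 1 < n" "coprime b n" "\<not> coprime (b + 1) n"
    using assms exists_unit_with_nonunit_successor_even exists_unit_with_nonunit_successor_odd
    by blast
  then show ?thesis
    using assms(1) latin_square_linear_square anti_king_linear_square not_anti_queen_linear_square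
    by (intro exI[of _ "linear_square n b"]) auto
qed

end
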